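(* Let $L\ge1$ be an integer and $0<s_v<1/2$. In protocol P2 (the signature protocol based on shared secret classical keys, described in the context), suppose Bob and Charlie are honest and Alice is arbitrary. Then the probability that Alice repudiates, i.e. that her declaration is accepted by Bob and, when forwarded, is rejected by Charlie, satisfies $$p({\rm rep})\le (1/2)^{s_vL}.$$
   Context: Protocol P2 (for one fixed possible message $m$), all transmissions below in the distribution stage being over secure (secret and authenticated) classical channels. Distribution stage: Alice sends a key ${\rm PrivKey}B_m\in\{0,1\}^L$ to Bob and a key ${\rm PrivKey}C_m\in\{0,1\}^L$ to Charlie (an honest Alice chooses these independently and uniformly at random). Each of Bob and Charlie, independently for each bit of his key, with probability $1/2$ sends that bit (with its position) to the other, and with probability $1/2$ does not; Alice does not learn these choices. (The protocol is aborted if the number of bits sent by either party to the other lies outside $[L(1/2-r),L(1/2+r)]$ for a parameter $0\le r<1/2$; an abort does not count as repudiation.) Each recipient remembers his entire own key. Messaging stage: Alice sends Bob a declaration consisting of $m$ and two strings of $L$ bits, claimed to be ${\rm PrivKey}B_m$ and ${\rm PrivKey}C_m$. Bob accepts if and only if the declaration agrees with all of his key ${\rm PrivKey}B_m$ and with all the bits of ${\rm PrivKey}C_m$ that Charlie sent him (authentication threshold $s_a=0$). Bob forwards the declaration to Charlie, who accepts if and only if (i) there is no mismatch between the declaration and the bits of ${\rm PrivKey}B_m$ that Bob sent him, and (ii) there are fewer than $s_vL$ positions of mismatch between the declaration and his key ${\rm PrivKey}C_m$. *)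

theory Defs
  imports "HOL-Probability.Probability"
begin

definition bitstrings :: "nat \<Rightarrow> bool list set" where
  "bitstrings L = {xs. length xs = L}"

text \<open>The message together with the strings claimed to be Bob's and Charlie's keys.\<close>

type_synonym 'msg decl = "'msg \<times> bool list \<times> bool list"

definition declarations :: "nat \<Rightarrow> 'msg \<Rightarrow> 'msg decl set" where
  "declarations L m = {m} \<times> bitstrings L \<times> bitstrings L"

text \<open>
  A possibly dishonest Alice is given by a joint law of the two keys she sends and of the
  information she retains, and by a randomised choice of what to declare from that information.
  This choice has no access to the coins of Bob and Charlie; that the protocol did not abort need
  not be passed to it, since she only declares in that case.  The type of retained
  information is arbitrary, so every joint law of keys and declared strings arises.
\<close>

definition valid_alice ::
  "nat \<Rightarrow> 'msg \<Rightarrow> (bool list \<times> bool list \<times> 'st) pmf \<Rightarrow> ('st \<Rightarrow> 'msg decl pmf) \<Rightarrow> bool"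
where
  "valid_alice L m distribute declare_msg \<longleftrightarrow>
     (\<forall>(keyB, keyC, st) \<in> set_pmf distribute.
        keyB \<in> bitstrings L \<and> keyC \<in> bitstrings L \<and>
        set_pmf (declare_msg st) \<subseteq> declarations L m)"

definition fair_coins :: "nat \<Rightarrow> (nat \<Rightarrow> bool) pmf" where
  "fair_coins L = Pi_pmf {..<L} False (\<lambda>_. bernoulli_pmf (1/2))"

text \<open>What the other recipient receives: the selected key bits with their positions.\<close>

definition sent_bits :: "bool list \<Rightarrow> (nat \<Rightarrow> bool) \<Rightarrow> (nat \<rightharpoonup> bool)" where
  "sent_bits key coins = (\<lambda>i. if i < length key \<and> coins i then Some (key ! i) else None)"

definition agrees :: "bool list \<Rightarrow> (nat \<rightharpoonup> bool) \<Rightarrow> bool" where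
  "agrees d received \<longleftrightarrow> (\<forall>i \<in> dom received. received i = Some (d ! i))"

definition admissible_count :: "nat \<Rightarrow> real \<Rightarrow> (nat \<rightharpoonup> bool) \<Rightarrow> bool" where
  "admissible_count L r sent \<longleftrightarrow>
     real (card (dom sent)) \<in> {real L * (1/2 - r) .. real L * (1/2 + r)}"

fun bob_accepts :: "bool list \<Rightarrow> (nat \<rightharpoonup> bool) \<Rightarrow> 'msg decl \<Rightarrow> bool" where
  "bob_accepts keyB fromC (msg, dB, dC) \<longleftrightarrow> dB = keyB \<and> agrees dC fromC"

fun charlie_accepts ::
  "nat \<Rightarrow> real \<Rightarrow> bool list \<Rightarrow> (nat \<rightharpoonup> bool) \<Rightarrow> 'msg decl \<Rightarrow> bool" where
  "charlie_accepts L s_v keyC fromB (msg, dB, dC) \<longleftrightarrow>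
     agrees dB fromB \<and> real (card {i. i < L \<and> dC ! i \<noteq> keyC ! i}) < s_v * real L"

datatype outcome = Aborted | Decisions (bob: bool) (charlie: bool)

definition protocol_P2 ::
  "nat \<Rightarrow> real \<Rightarrow> real \<Rightarrow> (bool list \<times> bool list \<times> 'st) pmf \<Rightarrow>
   ('st \<Rightarrow> 'msg decl pmf) \<Rightarrow> outcome pmf"
where
  "protocol_P2 L r s_v distribute declare_msg =
     do {
       (keyB, keyC, st) \<leftarrow> distribute;
       coinsB \<leftarrow> fair_coins L;
       coinsC \<leftarrow> fair_coins L;
       let fromB = sent_bits keyB coinsB;
       let fromC = sent_bits keyC coinsC;
       if admissible_count L r fromB \<and> admissible_count L r fromC
       then do {
         d \<leftarrow> declare_msg st;
         return_pmf (Decisions (bob_accepts keyB fromC d) (charlie_accepts L s_v keyC fromB d))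
       }
       else return_pmf Aborted
     }"

definition p_rep ::
  "nat \<Rightarrow> real \<Rightarrow> real \<Rightarrow> (bool list \<times> bool list \<times> 'st) pmf \<Rightarrow>
   ('st \<Rightarrow> 'msg decl pmf) \<Rightarrow> real"
where
  "p_rep L r s_v distribute declare_msg =
     measure_pmf.prob (protocol_P2 L r s_v distribute declare_msg)
       {Decisions True False}"

end

theory Submission imports Defs begin

text \<open>
  Once Bob accepts, the declared string for his own key is correct, so Charlie can only reject
  because the set \<open>M\<close> of positions where the declaration differs from Charlie's key has at least
  \<open>s_v * L\<close> elements.  Bob accepts only if Charlie sent him none of the bits in \<open>M\<close>, and Charlie's
  coins are independent of the keys and of the declaration, so this has probability
  \<open>(1/2) ^ card M\<close>.
\<close>

text \<open>A mixture cannot exceed its worst component. This reduces an arbitrary strategy of Alice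
  to fixed keys and a fixed declaration.\<close>

lemma pmf_bind_le:
  assumes "\<And>x. x \<in> set_pmf p \<Longrightarrow> pmf (f x) y \<le> c"
  shows "pmf (p \<bind> f) y \<le> c"
  unfolding pmf_bind
  by (intro measure_pmf.integral_le_const measure_pmf.integrable_const_bound[where B = 1])
    (auto simp: pmf_le_1 AE_measure_pmf_iff assms)

lemma prob_fair_coins_all_False:
  assumes "M \<subseteq> {..<L}"
  shows "measure_pmf.prob (fair_coins L) {c. \<forall>i\<in>M. \<not> c i} = (1/2) ^ card M"
proof -
  \<comment> \<open>The event is a box in the product space: positions outside \<open>M\<close> are
    unconstrained and contribute a factor 1.\<close>
  have "measure_pmf.prob (fair_coins L) {c. \<forall>i\<in>M. \<not> c i}
      = measure_pmf.prob (fair_coins L) (Pi {..<L} (\<lambda>i. if i \<in> M then {False} else UNIV))"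
    using assms by (intro arg_cong[where f = "measure_pmf.prob _"]) (auto simp: Pi_def)
  also have "\<dots> = (\<Prod>i<L. measure_pmf.prob (bernoulli_pmf (1/2)) (if i \<in> M then {False} else UNIV))"
    unfolding fair_coins_def by (rule measure_Pi_pmf_Pi) auto
  also have "\<dots> = (\<Prod>i<L. if i \<in> M then 1/2 else 1)"
    by (intro prod.cong refl) (simp add: measure_pmf_single)
  also have "\<dots> = (1/2) ^ card M"
    using assms by (simp add: prod.If_cases Int_absorb1)
  finally show ?thesis .
qed

lemma agrees_sent_bits_iff:
  "agrees d (sent_bits key coins) \<longleftrightarrow> (\<forall>i < length key. coins i \<longrightarrow> d ! i = key ! i)"
  by (auto simp: agrees_def sent_bits_def dom_def)

text \<open>\<open>coinsB\<close> may be any fixed value: it enters only through Charlie's check of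
  Bob's bits, which succeeds whenever \<open>dB = keyB\<close>.\<close>

lemma prob_bob_accepts_charlie_rejects:
  assumes "length keyC = L"
  shows "measure_pmf.prob (fair_coins L)
      {coinsC. bob_accepts keyB (sent_bits keyC coinsC) d \<and>
               \<not> charlie_accepts L s_v keyC (sent_bits keyB coinsB) d}
    \<le> (1/2) powr (s_v * real L)"
proof -
  obtain msg dB dC where d: "d = (msg, dB, dC)" by (cases d)
  define M where "M = {i. i < L \<and> dC ! i \<noteq> keyC ! i}"
  show ?thesis
  \<comment> \<open>Neither condition involves \<open>coinsC\<close>; if one fails, the event is
    empty.\<close>
  proof (cases "dB = keyB \<and> s_v * real L \<le> real (card M)")
    case True
    have "measure_pmf.prob (fair_coins L)
        {coinsC. bob_accepts keyB (sent_bits keyC coinsC) d \<and>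
                 \<not> charlie_accepts L s_v keyC (sent_bits keyB coinsB) d}
      \<le> measure_pmf.prob (fair_coins L) {c. \<forall>i\<in>M. \<not> c i}"
      using assms
      by (intro measure_pmf.finite_measure_mono) (auto simp: d M_def agrees_sent_bits_iff)
    also have "\<dots> = (1/2) powr real (card M)"
      by (subst prob_fair_coins_all_False) (auto simp: M_def powr_realpow)
    also have "\<dots> \<le> (1/2) powr (s_v * real L)"
      using True by (intro powr_mono') auto
    finally show ?thesis .
  next
    case False
    then have "{coinsC. bob_accepts keyB (sent_bits keyC coinsC) d \<and>
                 \<not> charlie_accepts L s_v keyC (sent_bits keyB coinsB) d} = {}"
      by (auto simp: d M_def agrees_sent_bits_iff)
    then show ?thesis by (simp only: measure_empty) simp
  qed
qed

text \<open>The declaration does not depend on the coins, so it may be drawn before them.\<close>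

lemma protocol_P2_declare_first:
  "protocol_P2 L r s_v distribute declare_msg =
     do {
       (keyB, keyC, st) \<leftarrow> distribute;
       d \<leftarrow> declare_msg st;
       coinsB \<leftarrow> fair_coins L;
       map_pmf (\<lambda>coinsC.
         let fromB = sent_bits keyB coinsB; fromC = sent_bits keyC coinsC
         in if admissible_count L r fromB \<and> admissible_count L r fromC
            then Decisions (bob_accepts keyB fromC d) (charlie_accepts L s_v keyC fromB d)
            else Aborted) (fair_coins L)
     }"
proof -
  \<comment> \<open>Drawing \<open>d\<close> in aborted runs too is harmless, since the result is
    discarded. The draw then no longer sits under a test on the coins, and the independent draws can
    be exchanged.\<close>
  have push: "(if b then p \<bind> (\<lambda>d. return_pmf (g d)) else return_pmf z)
      = p \<bind> (\<lambda>d. return_pmf (if b then g d else z))"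
    for b z and p :: "'d pmf" and g :: "'d \<Rightarrow> outcome"
    by simp
  show ?thesis
    unfolding protocol_P2_def Let_def push map_pmf_def
    by (subst (2) bind_commute_pmf, subst bind_commute_pmf) (rule refl)
qed

theorem mainTheorem3:
  fixes L :: nat and s_v r :: real and m :: 'msg
    and distribute :: "(bool list \<times> bool list \<times> 'st) pmf"
    and declare_msg :: "'st \<Rightarrow> 'msg decl pmf"
  assumes "L \<ge> 1"
    and "0 < s_v" and "s_v < 1/2"
    and "0 \<le> r" and "r < 1/2"
    and "valid_alice L m distribute declare_msg"
  shows "p_rep L r s_v distribute declare_msg \<le> (1/2) powr (s_v * real L)"
proof -
  have "pmf (protocol_P2 L r s_v distribute declare_msg) (Decisions True False)
      \<le> (1/2) powr (s_v * real L)"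
    unfolding protocol_P2_declare_first
  \<comment> \<open>The three uses fix, in turn, the keys with Alice's state, the declaration, and
    Bob's coins; only Charlie's coins stay random.\<close>
  proof (rule pmf_bind_le, clarify, rule pmf_bind_le, rule pmf_bind_le)
    fix keyB keyC st d coinsB
    assume "(keyB, keyC, st) \<in> set_pmf distribute"
    then have "length keyC = L"
      using assms(6) by (auto simp: valid_alice_def bitstrings_def)
    let ?g = "\<lambda>coinsC.
      let fromB = sent_bits keyB coinsB; fromC = sent_bits keyC coinsC
      in if admissible_count L r fromB \<and> admissible_count L r fromC
         then Decisions (bob_accepts keyB fromC d) (charlie_accepts L s_v keyC fromB d)
         else Aborted"
    have "pmf (map_pmf ?g (fair_coins L)) (Decisions True False)
        = measure_pmf.prob (fair_coins L) (?g -` {Decisions True False})"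
      by (rule pmf_map)
    \<comment> \<open>Forgetting the abort test only enlarges the event, so the bound does not
      depend on \<open>r\<close>.\<close>
    also have "\<dots> \<le> measure_pmf.prob (fair_coins L)
        {coinsC. bob_accepts keyB (sent_bits keyC coinsC) d \<and>
                 \<not> charlie_accepts L s_v keyC (sent_bits keyB coinsB) d}"
      by (intro measure_pmf.finite_measure_mono) (auto simp: Let_def split: if_splits)
    also have "\<dots> \<le> (1/2) powr (s_v * real L)"
      using \<open>length keyC = L\<close> by (rule prob_bob_accepts_charlie_rejects)
    finally show "pmf (map_pmf ?g (fair_coins L)) (Decisions True False)
        \<le> (1/2) powr (s_v * real L)" .
  qed
  then show ?thesis by (simp add: p_rep_def measure_pmf_single)
qed

end
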